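(* Let $a,b,q$ be real constants, let $f=f(x^3,x^4)$ be a nowhere vanishing smooth function, and let $M$ be a connected open region of coordinates $(t,r,x^3,x^4)$ with $r\neq0$, equipped with the Robinson-Trautman metric $$ds^2=-2(a-2br-qr^{-1})\,dt^2+2\,dt\,dr-\frac{r^2}{f^2}\left[(dx^3)^2+(dx^4)^2\right].$$ Put $F=f_3^2+f_4^2-f(f_{33}+f_{44})$, where subscripts denote partial derivatives in $x^3,x^4$, and let $$T=\frac{c^4}{8\pi G}\left[S-\left(\frac{\kappa}{2}-\Lambda\right)g\right]$$ be the energy-momentum tensor. Then the following conditions are equivalent: (i) $T$ is covariantly constant, i.e. $\nabla T=0$; (ii) $T$ is of Codazzi type, i.e. $(\nabla_{X_1}T)(X_2,X_3)=(\nabla_{X_2}T)(X_1,X_3)$ for all vector fields $X_1,X_2,X_3$; (iii) $T$ is cyclic parallel, i.e. $(\nabla_{X_1}T)(X_2,X_3)+(\nabla_{X_2}T)(X_3,X_1)+(\nabla_{X_3}T)(X_1,X_2)=0$ for all vector fields $X_1,X_2,X_3$; (iv) $b=0$ and $F=2a$ (identically).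
   Context: $\nabla$ is the Levi-Civita connection of $g$; $c>0$, $G>0$ (speed of light, gravitational constant) and $\Lambda\in\mathbb R$ (cosmological constant) are constants. $S$ and $\kappa$ are the Ricci tensor and scalar curvature, with the sign convention $\mathcal R(X,Y)Z=\nabla_Y\nabla_XZ-\nabla_X\nabla_YZ+\nabla_{[X,Y]}Z$, $R(X_1,X_2,X_3,X_4)=g(\mathcal R(X_1,X_2)X_3,X_4)$, $S_{jk}=g^{il}R_{ijkl}$, $\kappa=g^{jk}S_{jk}$; with coordinates numbered $(t,r,x^3,x^4)=(x^1,x^2,x^3,x^4)$ this gives for this metric $S_{12}=-\frac{4b}{r}$, $S_{33}=S_{44}=-\frac{2a-8br-F}{f^2}$, $\kappa=-\frac{2(-2a+12br+F)}{r^2}$. *)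

theory Defs
  imports "HOL-Analysis.Analysis"
begin

section \<open>Smooth functions and vector fields on open subsets of \<open>\<real>\<^sup>n\<close>\<close>

definition pd :: "'n::finite \<Rightarrow> (real^'n \<Rightarrow> real) \<Rightarrow> real^'n \<Rightarrow> real" where
  "pd i \<phi> p = deriv (\<lambda>h. \<phi> (p + h *\<^sub>R axis i 1)) 0"

text \<open>Meaningful for open \<open>U\<close> only. Since every \<open>C\<^sup>1\<close> function is (Frechet) differentiable,
  the differentiability demanded in the successor case does not exclude any \<open>C\<^sup>k\<close> function; it
  guarantees that the partial derivatives exist.\<close>

primrec Ck_on :: "nat \<Rightarrow> (real^'n) set \<Rightarrow> (real^'n \<Rightarrow> real) \<Rightarrow> bool" where
  "Ck_on 0 U \<phi> \<longleftrightarrow> continuous_on U \<phi>"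
| "Ck_on (Suc k) U \<phi> \<longleftrightarrow> (\<forall>p\<in>U. \<phi> differentiable (at p)) \<and> (\<forall>i. Ck_on k U (pd i \<phi>))"

definition smooth_on :: "(real^'n) set \<Rightarrow> (real^'n \<Rightarrow> real) \<Rightarrow> bool" where
  "smooth_on U \<phi> \<longleftrightarrow> (\<forall>k. Ck_on k U \<phi>)"

type_synonym 'n vfield = "real^'n \<Rightarrow> real^'n"
type_synonym 'n tensor2 = "real^'n \<Rightarrow> real^'n^'n"

definition smooth_vfield_on :: "(real^'n) set \<Rightarrow> 'n vfield \<Rightarrow> bool" where
  "smooth_vfield_on U X \<longleftrightarrow> (\<forall>i. smooth_on U (\<lambda>p. X p $ i))"

definition coord_field :: "'n::finite \<Rightarrow> 'n vfield" where
  "coord_field i = (\<lambda>p. axis i 1)"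

definition vf_apply :: "'n::finite vfield \<Rightarrow> (real^'n \<Rightarrow> real) \<Rightarrow> real^'n \<Rightarrow> real" where
  "vf_apply X \<phi> p = (\<Sum>i\<in>UNIV. X p $ i * pd i \<phi> p)"

definition lie_bracket :: "'n::finite vfield \<Rightarrow> 'n vfield \<Rightarrow> 'n vfield" where
  "lie_bracket X Y p = (\<chi> k. vf_apply X (\<lambda>x. Y x $ k) p - vf_apply Y (\<lambda>x. X x $ k) p)"

definition tensor_eval :: "'n::finite tensor2 \<Rightarrow> 'n vfield \<Rightarrow> 'n vfield \<Rightarrow> real^'n \<Rightarrow> real" where
  "tensor_eval T X Y p = (\<Sum>i\<in>UNIV. \<Sum>j\<in>UNIV. T p $ i $ j * X p $ i * Y p $ j)"

section \<open>The Levi-Civita connection in a coordinate domain\<close>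

definition christoffel :: "'n::finite tensor2 \<Rightarrow> 'n \<Rightarrow> 'n \<Rightarrow> 'n \<Rightarrow> real^'n \<Rightarrow> real" where
  "christoffel g k i j p =
     (\<Sum>l\<in>UNIV. matrix_inv (g p) $ k $ l *
        (pd i (\<lambda>x. g x $ j $ l) p + pd j (\<lambda>x. g x $ i $ l) p - pd l (\<lambda>x. g x $ i $ j) p)) / 2"

text \<open>\<open>levi_civita g X Y\<close> is \<open>\<nabla>\<^sub>X Y\<close>.\<close>

definition levi_civita :: "'n::finite tensor2 \<Rightarrow> 'n vfield \<Rightarrow> 'n vfield \<Rightarrow> 'n vfield" where
  "levi_civita g X Y p =
     (\<chi> k. vf_apply X (\<lambda>x. Y x $ k) p
         + (\<Sum>i\<in>UNIV. \<Sum>j\<in>UNIV. christoffel g k i j p * X p $ i * Y p $ j))"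

text \<open>\<open>cov_deriv g T X Y Z\<close> is the function \<open>(\<nabla>\<^sub>X T)(Y, Z)\<close>.\<close>

definition cov_deriv ::
  "'n::finite tensor2 \<Rightarrow> 'n tensor2 \<Rightarrow> 'n vfield \<Rightarrow> 'n vfield \<Rightarrow> 'n vfield \<Rightarrow> real^'n \<Rightarrow> real" where
  "cov_deriv g T X Y Z p =
     vf_apply X (tensor_eval T Y Z) p
     - tensor_eval T (levi_civita g X Y) Z p - tensor_eval T Y (levi_civita g X Z) p"

text \<open>The two defining properties of the Levi-Civita connection: it is torsion-free and metric.\<close>

lemma pd_symmetric_tensor:
  assumes "open U" "p \<in> U" "\<And>x. x \<in> U \<Longrightarrow> transpose (g x) = g x"
  shows "pd l (\<lambda>x. g x $ i $ j) p = pd l (\<lambda>x. g x $ j $ i) p"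
proof -
  have sym_entry: "g x $ i $ j = g x $ j $ i" if "x \<in> U" for x
    using arg_cong[OF assms(3)[OF that], of "\<lambda>A. A $ j $ i"] by (simp add: transpose_def)
  have "((\<lambda>h. p + h *\<^sub>R axis l 1) \<longlongrightarrow> p + 0 *\<^sub>R axis l 1) (nhds (0::real))"
    by (intro tendsto_intros filterlim_ident)
  hence "eventually (\<lambda>h. p + h *\<^sub>R axis l 1 \<in> U) (nhds (0::real))"
    using topological_tendstoD[of _ _ _ U] assms(1,2) by auto
  hence "eventually (\<lambda>h. g (p + h *\<^sub>R axis l 1) $ i $ j = g (p + h *\<^sub>R axis l 1) $ j $ i) (nhds 0)"
    by eventually_elim (rule sym_entry)
  thus ?thesis unfolding pd_def by (intro deriv_cong_ev) auto
qed

lemma christoffel_commute: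
  assumes "open U" "p \<in> U" "\<And>x. x \<in> U \<Longrightarrow> transpose (g x) = g x"
  shows "christoffel g k i j p = christoffel g k j i p"
proof -
  have "pd l (\<lambda>x. g x $ i $ j) p = pd l (\<lambda>x. g x $ j $ i) p" for l
    by (rule pd_symmetric_tensor[OF assms])
  thus ?thesis unfolding christoffel_def by (simp only: add.commute)
qed

lemma christoffel_lower:
  assumes "invertible (g p)"
  shows "(\<Sum>k\<in>UNIV. g p $ m $ k * christoffel g k i j p) =
    (pd i (\<lambda>x. g x $ j $ m) p + pd j (\<lambda>x. g x $ i $ m) p - pd m (\<lambda>x. g x $ i $ j) p) / 2"
proof -
  define d where
    "d l = pd i (\<lambda>x. g x $ j $ l) p + pd j (\<lambda>x. g x $ i $ l) p - pd l (\<lambda>x. g x $ i $ j) p" for l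
  have "g p ** matrix_inv (g p) = mat 1"
    using assms unfolding invertible_def matrix_inv_def by (rule someI2_ex) auto
  hence inv: "(\<Sum>k\<in>UNIV. g p $ m $ k * matrix_inv (g p) $ k $ l) = (if m = l then 1 else 0)" for l
    unfolding matrix_matrix_mult_def mat_def by (simp add: vec_eq_iff)
  have "(\<Sum>k\<in>UNIV. g p $ m $ k * christoffel g k i j p) =
    (\<Sum>k\<in>UNIV. \<Sum>l\<in>UNIV. g p $ m $ k * matrix_inv (g p) $ k $ l * d l) / 2"
    unfolding christoffel_def d_def[symmetric]
    by (simp add: sum_divide_distrib sum_distrib_left mult.assoc)
  also have "\<dots> = (\<Sum>l\<in>UNIV. (\<Sum>k\<in>UNIV. g p $ m $ k * matrix_inv (g p) $ k $ l) * d l) / 2"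
    by (subst sum.swap) (simp add: sum_distrib_right)
  also have "\<dots> = d m / 2" by (simp add: inv mult_delta_left)
  finally show ?thesis unfolding d_def .
qed

lemma levi_civita_torsion_free:
  assumes "open U" "p \<in> U" "\<And>x. x \<in> U \<Longrightarrow> transpose (g x) = g x"
  shows "levi_civita g X Y p - levi_civita g Y X p = lie_bracket X Y p"
proof -
  have "(\<Sum>i\<in>UNIV. \<Sum>j\<in>UNIV. christoffel g k i j p * X p $ i * Y p $ j) =
        (\<Sum>i\<in>UNIV. \<Sum>j\<in>UNIV. christoffel g k i j p * Y p $ i * X p $ j)" for k
  proof (subst sum.swap, intro sum.cong refl)
    fix i j
    have "christoffel g k j i p = christoffel g k i j p" by (rule christoffel_commute[OF assms])
    thus "christoffel g k j i p * X p $ j * Y p $ i = christoffel g k i j p * Y p $ i * X p $ j"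
      by simp
  qed
  thus ?thesis unfolding levi_civita_def lie_bracket_def by (simp add: vec_eq_iff)
qed

lemma pd_eqI:
  assumes "(\<phi> has_derivative D) (at p)"
  shows "pd i \<phi> p = D (axis i 1)"
proof -
  have "((\<lambda>h. p + h *\<^sub>R axis i 1) has_derivative (\<lambda>h. h *\<^sub>R axis i 1)) (at (0::real))"
    by (auto intro!: derivative_eq_intros)
  from has_derivative_compose[OF this, of \<phi> D] assms
  have "((\<lambda>h. \<phi> (p + h *\<^sub>R axis i 1)) has_derivative (\<lambda>h. D (h *\<^sub>R axis i 1))) (at 0)" by simp
  moreover have "D (h *\<^sub>R axis i 1) = D (axis i 1) * h" for h
    using linear_scale[OF has_derivative_linear[OF assms]] by simp
  ultimately have "((\<lambda>h. \<phi> (p + h *\<^sub>R axis i 1)) has_real_derivative D (axis i 1)) (at 0)"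
    by (simp add: has_field_derivative_def)
  thus ?thesis unfolding pd_def by (rule DERIV_imp_deriv)
qed

lemma levi_civita_metric:
  fixes g :: "'n::finite tensor2"
  assumes "open U" "p \<in> U" and sym: "\<And>x. x \<in> U \<Longrightarrow> transpose (g x) = g x"
    and inv: "invertible (g p)"
    and dg: "\<And>i j. (\<lambda>x. g x $ i $ j) differentiable (at p)"
    and dY: "\<And>i. (\<lambda>x. Y x $ i) differentiable (at p)"
    and dZ: "\<And>i. (\<lambda>x. Z x $ i) differentiable (at p)"
  shows "cov_deriv g g X Y Z p = 0"
proof -
  have hd: "(\<phi> has_derivative frechet_derivative \<phi> (at p)) (at p)" if "\<phi> differentiable (at p)" for \<phi> :: "real^'n \<Rightarrow> real"
    using that by (simp add: frechet_derivative_works)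
  have pdfd: "frechet_derivative \<phi> (at p) (axis m 1) = pd m \<phi> p" if "\<phi> differentiable (at p)" for \<phi> :: "real^'n \<Rightarrow> real" and m
    using pd_eqI[OF hd[OF that]] by simp
  have gs: "g p $ i $ j = g p $ j $ i" for i j
    using arg_cong[OF sym[OF assms(2)], of "\<lambda>A. A $ j $ i"] by (simp add: transpose_def)
  define x where "x m = X p $ m" for m
  define y where "y m = Y p $ m" for m
  define z where "z m = Z p $ m" for m
  define \<gamma> where "\<gamma> i j = g p $ i $ j" for i j
  define dy where "dy m i = pd m (\<lambda>x. Y x $ i) p" for m i
  define dz where "dz m i = pd m (\<lambda>x. Z x $ i) p" for m i
  define e where "e m i j = pd m (\<lambda>x. g x $ i $ j) p" for m i j
  define C where "C k i j = christoffel g k i j p" for k i j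
  have es: "e m i j = e m j i" for m i j
    unfolding e_def by (rule pd_symmetric_tensor[OF assms(1-3)])
  have \<gamma>s: "\<gamma> i j = \<gamma> j i" for i j unfolding \<gamma>_def by (rule gs)
  have low: "(\<Sum>k\<in>UNIV. \<gamma> m k * C k i j) = (e i j m + e j i m - e m i j) / 2" for m i j
    unfolding \<gamma>_def C_def e_def by (rule christoffel_lower[where g=g, OF inv])
  have "pd m (tensor_eval g Y Z) p =
      (\<Sum>i\<in>UNIV. \<Sum>j\<in>UNIV. e m i j * y i * z j + \<gamma> i j * dy m i * z j + \<gamma> i j * y i * dz m j)" for m
  proof -
    have "(tensor_eval g Y Z has_derivative (\<lambda>h. \<Sum>i\<in>UNIV. \<Sum>j\<in>UNIV.
        (g p $ i $ j * Y p $ i) * frechet_derivative (\<lambda>x. Z x $ j) (at p) h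
        + (g p $ i $ j * frechet_derivative (\<lambda>x. Y x $ i) (at p) h
        + frechet_derivative (\<lambda>x. g x $ i $ j) (at p) h * Y p $ i) * Z p $ j)) (at p)"
      unfolding tensor_eval_def[abs_def]
      by (intro has_derivative_sum has_derivative_mult hd dg dY dZ)
    from pd_eqI[OF this, of m] show ?thesis
      by (simp add: pdfd[OF dg] pdfd[OF dY] pdfd[OF dZ] e_def dy_def dz_def y_def z_def \<gamma>_def algebra_simps)
  qed
  hence L: "vf_apply X (tensor_eval g Y Z) p =
      (\<Sum>m\<in>UNIV. \<Sum>i\<in>UNIV. \<Sum>j\<in>UNIV. x m * e m i j * y i * z j)
    + (\<Sum>m\<in>UNIV. \<Sum>i\<in>UNIV. \<Sum>j\<in>UNIV. \<gamma> i j * x m * dy m i * z j)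
    + (\<Sum>m\<in>UNIV. \<Sum>i\<in>UNIV. \<Sum>j\<in>UNIV. \<gamma> i j * y i * x m * dz m j)"
    unfolding vf_apply_def x_def[symmetric]
    by (simp add: sum_distrib_left sum.distrib algebra_simps)
  have A: "tensor_eval g (levi_civita g X Y) Z p =
      (\<Sum>m\<in>UNIV. \<Sum>i\<in>UNIV. \<Sum>j\<in>UNIV. \<gamma> i j * x m * dy m i * z j)
    + (\<Sum>m\<in>UNIV. \<Sum>n\<in>UNIV. \<Sum>j\<in>UNIV. (\<Sum>i\<in>UNIV. \<gamma> j i * C i m n) * x m * y n * z j)"
  proof -
    have "tensor_eval g (levi_civita g X Y) Z p =
        (\<Sum>i\<in>UNIV. \<Sum>j\<in>UNIV. \<Sum>m\<in>UNIV. \<gamma> i j * x m * dy m i * z j)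
      + (\<Sum>i\<in>UNIV. \<Sum>j\<in>UNIV. \<Sum>m\<in>UNIV. \<Sum>n\<in>UNIV. \<gamma> i j * C i m n * x m * y n * z j)"
      unfolding tensor_eval_def levi_civita_def vf_apply_def
      by (simp add: x_def y_def z_def \<gamma>_def dy_def C_def sum_distrib_left sum_distrib_right
          sum.distrib algebra_simps)
    also have "(\<Sum>i\<in>UNIV. \<Sum>j\<in>UNIV. \<Sum>m\<in>UNIV. \<gamma> i j * x m * dy m i * z j) =
        (\<Sum>m\<in>UNIV. \<Sum>i\<in>UNIV. \<Sum>j\<in>UNIV. \<gamma> i j * x m * dy m i * z j)"
      by (subst (2) sum.swap, subst sum.swap) simp
    also have "(\<Sum>i\<in>UNIV. \<Sum>j\<in>UNIV. \<Sum>m\<in>UNIV. \<Sum>n\<in>UNIV. \<gamma> i j * C i m n * x m * y n * z j) =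
        (\<Sum>m\<in>UNIV. \<Sum>n\<in>UNIV. \<Sum>j\<in>UNIV. \<Sum>i\<in>UNIV. \<gamma> i j * C i m n * x m * y n * z j)"
      unfolding sum.cartesian_product
      by (rule sum.reindex_bij_witness[where i="\<lambda>(m,n,j,i). (i,j,m,n)" and j="\<lambda>(i,j,m,n). (m,n,j,i)"]) auto
    finally show ?thesis by (simp add: sum_distrib_right \<gamma>s)
  qed
  have B: "tensor_eval g Y (levi_civita g X Z) p =
      (\<Sum>m\<in>UNIV. \<Sum>i\<in>UNIV. \<Sum>j\<in>UNIV. \<gamma> i j * y i * x m * dz m j)
    + (\<Sum>m\<in>UNIV. \<Sum>i\<in>UNIV. \<Sum>n\<in>UNIV. (\<Sum>j\<in>UNIV. \<gamma> i j * C j m n) * x m * y i * z n)"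
  proof -
    have "tensor_eval g Y (levi_civita g X Z) p =
        (\<Sum>i\<in>UNIV. \<Sum>j\<in>UNIV. \<Sum>m\<in>UNIV. \<gamma> i j * y i * x m * dz m j)
      + (\<Sum>i\<in>UNIV. \<Sum>j\<in>UNIV. \<Sum>m\<in>UNIV. \<Sum>n\<in>UNIV. \<gamma> i j * C j m n * x m * y i * z n)"
      unfolding tensor_eval_def levi_civita_def vf_apply_def
      by (simp add: x_def y_def z_def \<gamma>_def dz_def C_def sum_distrib_left sum_distrib_right
          sum.distrib algebra_simps)
    also have "(\<Sum>i\<in>UNIV. \<Sum>j\<in>UNIV. \<Sum>m\<in>UNIV. \<gamma> i j * y i * x m * dz m j) =
        (\<Sum>m\<in>UNIV. \<Sum>i\<in>UNIV. \<Sum>j\<in>UNIV. \<gamma> i j * y i * x m * dz m j)"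
      by (subst (2) sum.swap, subst sum.swap) simp
    also have "(\<Sum>i\<in>UNIV. \<Sum>j\<in>UNIV. \<Sum>m\<in>UNIV. \<Sum>n\<in>UNIV. \<gamma> i j * C j m n * x m * y i * z n) =
        (\<Sum>m\<in>UNIV. \<Sum>i\<in>UNIV. \<Sum>n\<in>UNIV. \<Sum>j\<in>UNIV. \<gamma> i j * C j m n * x m * y i * z n)"
      unfolding sum.cartesian_product
      by (rule sum.reindex_bij_witness[where i="\<lambda>(m,i,n,j). (i,j,m,n)" and j="\<lambda>(i,j,m,n). (m,i,n,j)"]) auto
    finally show ?thesis by (simp add: sum_distrib_right)
  qed
  have "(\<Sum>m\<in>UNIV. \<Sum>n\<in>UNIV. \<Sum>j\<in>UNIV. (\<Sum>i\<in>UNIV. \<gamma> j i * C i m n) * x m * y n * z j)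
      + (\<Sum>m\<in>UNIV. \<Sum>i\<in>UNIV. \<Sum>n\<in>UNIV. (\<Sum>j\<in>UNIV. \<gamma> i j * C j m n) * x m * y i * z n)
      = (\<Sum>m\<in>UNIV. \<Sum>i\<in>UNIV. \<Sum>j\<in>UNIV. x m * e m i j * y i * z j)"
    unfolding low sum.distrib[symmetric]
  proof (intro sum.cong refl)
    fix m i j
    have "e j m i = e j i m" "e i m j = e i j m" "e m j i = e m i j" by (rule es)+
    thus "(e m i j + e i m j - e j m i) / 2 * x m * y i * z j
        + (e m j i + e j m i - e i m j) / 2 * x m * y i * z j = x m * e m i j * y i * z j"
      by (simp add: field_simps)
  qed
  with L A B show ?thesis unfolding cov_deriv_def by simp
qed

section \<open>Curvature and the energy-momentum tensor\<close>

text \<open>The sign of the curvature operator is the opposite of the most common one.\<close>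

definition curvature_op :: "'n::finite tensor2 \<Rightarrow> 'n vfield \<Rightarrow> 'n vfield \<Rightarrow> 'n vfield \<Rightarrow> 'n vfield" where
  "curvature_op g X Y Z p =
     levi_civita g Y (levi_civita g X Z) p - levi_civita g X (levi_civita g Y Z) p
     + levi_civita g (lie_bracket X Y) Z p"

definition riemann ::
  "'n::finite tensor2 \<Rightarrow> 'n vfield \<Rightarrow> 'n vfield \<Rightarrow> 'n vfield \<Rightarrow> 'n vfield \<Rightarrow> real^'n \<Rightarrow> real" where
  "riemann g X1 X2 X3 X4 p = tensor_eval g (curvature_op g X1 X2 X3) X4 p"

definition ricci :: "'n::finite tensor2 \<Rightarrow> 'n tensor2" where
  "ricci g p = (\<chi> j k. \<Sum>i\<in>UNIV. \<Sum>l\<in>UNIV. matrix_inv (g p) $ i $ l *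
      riemann g (coord_field i) (coord_field j) (coord_field k) (coord_field l) p)"

definition scalar_curvature :: "'n::finite tensor2 \<Rightarrow> real^'n \<Rightarrow> real" where
  "scalar_curvature g p = (\<Sum>j\<in>UNIV. \<Sum>k\<in>UNIV. matrix_inv (g p) $ j $ k * ricci g p $ j $ k)"

definition energy_momentum :: "real \<Rightarrow> real \<Rightarrow> real \<Rightarrow> 'n::finite tensor2 \<Rightarrow> 'n tensor2" where
  "energy_momentum c G \<Lambda> g p =
     (c ^ 4 / (8 * pi * G)) *\<^sub>R (ricci g p - (scalar_curvature g p / 2 - \<Lambda>) *\<^sub>R g p)"

section \<open>Conditions on a symmetric tensor field\<close>

definition covariantly_constant_on :: "(real^'n::finite) set \<Rightarrow> 'n tensor2 \<Rightarrow> 'n tensor2 \<Rightarrow> bool" where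
  "covariantly_constant_on M g T \<longleftrightarrow>
     (\<forall>X1 X2 X3. smooth_vfield_on M X1 \<longrightarrow> smooth_vfield_on M X2 \<longrightarrow> smooth_vfield_on M X3 \<longrightarrow>
        (\<forall>p\<in>M. cov_deriv g T X1 X2 X3 p = 0))"

definition codazzi_on :: "(real^'n::finite) set \<Rightarrow> 'n tensor2 \<Rightarrow> 'n tensor2 \<Rightarrow> bool" where
  "codazzi_on M g T \<longleftrightarrow>
     (\<forall>X1 X2 X3. smooth_vfield_on M X1 \<longrightarrow> smooth_vfield_on M X2 \<longrightarrow> smooth_vfield_on M X3 \<longrightarrow>
        (\<forall>p\<in>M. cov_deriv g T X1 X2 X3 p = cov_deriv g T X2 X1 X3 p))"

definition cyclic_parallel_on :: "(real^'n::finite) set \<Rightarrow> 'n tensor2 \<Rightarrow> 'n tensor2 \<Rightarrow> bool" where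
  "cyclic_parallel_on M g T \<longleftrightarrow>
     (\<forall>X1 X2 X3. smooth_vfield_on M X1 \<longrightarrow> smooth_vfield_on M X2 \<longrightarrow> smooth_vfield_on M X3 \<longrightarrow>
        (\<forall>p\<in>M. cov_deriv g T X1 X2 X3 p + cov_deriv g T X2 X3 X1 p + cov_deriv g T X3 X1 X2 p = 0))"

section \<open>The Robinson-Trautman metric\<close>

text \<open>A point of \<open>\<real>\<^sup>4\<close> has coordinates \<open>(t, r, x\<^sup>3, x\<^sup>4) = (p $ 1, p $ 2, p $ 3, p $ 4)\<close>. The
  function \<open>f\<close> lives on the \<open>(x\<^sup>3, x\<^sup>4)\<close>-plane, so its partial derivatives with respect to
  \<open>x\<^sup>3\<close> and \<open>x\<^sup>4\<close> are \<open>pd 1 f\<close> and \<open>pd 2 f\<close>.\<close>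

definition proj34 :: "real^4 \<Rightarrow> real^2" where
  "proj34 p = vector [p $ 3, p $ 4]"

definition robinson_trautman :: "real \<Rightarrow> real \<Rightarrow> real \<Rightarrow> (real^2 \<Rightarrow> real) \<Rightarrow> 4 tensor2" where
  "robinson_trautman a b q f p =
     (let r = p $ 2; w = - (r\<^sup>2 / (f (proj34 p))\<^sup>2) in
      vector [vector [- 2 * (a - 2 * b * r - q / r), 1, 0, 0],
              vector [1, 0, 0, 0],
              vector [0, 0, w, 0],
              vector [0, 0, 0, w]])"

definition RT_F :: "(real^2 \<Rightarrow> real) \<Rightarrow> real^2 \<Rightarrow> real" where
  "RT_F f x = (pd 1 f x)\<^sup>2 + (pd 2 f x)\<^sup>2 - f x * (pd 1 (pd 1 f) x + pd 2 (pd 2 f) x)"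

lemma vector_4:
  "(vector [w, x, y, z] :: 'a::zero^4) $ 1 = w" "(vector [w, x, y, z] :: 'a^4) $ 2 = x"
  "(vector [w, x, y, z] :: 'a^4) $ 3 = y" "(vector [w, x, y, z] :: 'a^4) $ 4 = z"
  unfolding vector_def by auto

lemma robinson_trautman_line_element:
  assumes "p $ 2 = r" "X p = v" "f (proj34 p) = f0"
  shows "tensor_eval (robinson_trautman a b q f) X X p =
    - 2 * (a - 2 * b * r - q / r) * (v $ 1)\<^sup>2 + 2 * v $ 1 * v $ 2
    - r\<^sup>2 / f0\<^sup>2 * ((v $ 3)\<^sup>2 + (v $ 4)\<^sup>2)"
  using assms
  by (simp add: tensor_eval_def robinson_trautman_def Let_def sum_4 vector_4
      power2_eq_square algebra_simps)

end

theory Submission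
  imports Defs
begin

text \<open>
  Write \<open>g = h + k\<close> with \<open>h\<close> the \<open>(t, r)\<close>-block and \<open>k\<close> the \<open>(x\<^sup>3, x\<^sup>4)\<close>-block of the metric. Both
  blocks of the Ricci tensor are multiples of those of \<open>g\<close>, and
  \<open>T = c\<^sup>4 / (8\<pi>G) [(\<Lambda> - (2a - 8br - F) / r\<^sup>2) h + (\<Lambda> + 4b / r) k]\<close>.
  Evaluated on the coordinate fields \<open>\<partial>\<^sub>2, \<partial>\<^sub>3, \<partial>\<^sub>3\<close>, the Codazzi condition reads \<open>8br = 2a - F\<close> and
  the cyclic condition \<open>2br = 2a - F\<close>. Since \<open>F\<close> does not depend on \<open>r\<close> and \<open>M\<close> is open, either
  one forces \<open>b = 0\<close> and \<open>F = 2a\<close>. Conversely, \<open>b = 0\<close> and \<open>F = 2a\<close> make the metric Ricci-flat,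
  so \<open>T\<close> is a constant multiple of \<open>g\<close>, hence parallel.
\<close>

section \<open>Partial derivatives\<close>

text \<open>\<open>pd\<close> is a total operation and says nothing where the derivative fails to
  exist. This relation carries existence along with the value, so derivatives can be composed by
  rules.\<close>

definition has_pd :: "'n::finite \<Rightarrow> (real^'n \<Rightarrow> real) \<Rightarrow> real \<Rightarrow> real^'n \<Rightarrow> bool" where
  "has_pd i \<phi> d p \<longleftrightarrow> ((\<lambda>h. \<phi> (p + h *\<^sub>R axis i 1)) has_real_derivative d) (at 0)"

lemma pd_eq: "has_pd i \<phi> d p \<Longrightarrow> pd i \<phi> p = d"
  unfolding has_pd_def pd_def by (rule DERIV_imp_deriv)

text \<open>Lets the derivative rules produce a raw value first; its comparison with the desired
  closed form is left as a separate goal.\<close>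

lemma has_pd_rhs: "has_pd i \<phi> d p \<Longrightarrow> d = e \<Longrightarrow> has_pd i \<phi> e p"
  by simp

lemma has_pd_differentiable:
  assumes "\<phi> differentiable (at p)"
  shows "has_pd i \<phi> (pd i \<phi> p) p"
proof -
  obtain D where D: "(\<phi> has_derivative D) (at p)"
    using assms unfolding differentiable_def by blast
  have "((\<lambda>h. p + h *\<^sub>R axis i 1) has_derivative (\<lambda>h. h *\<^sub>R axis i 1)) (at (0::real))"
    by (auto intro!: derivative_eq_intros)
  from has_derivative_compose[OF this, of \<phi> D] D
  have "((\<lambda>h. \<phi> (p + h *\<^sub>R axis i 1)) has_derivative (\<lambda>h. D (h *\<^sub>R axis i 1))) (at 0)" by simp
  moreover have "D (h *\<^sub>R axis i 1) = D (axis i 1) * h" for h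
    using linear_scale[OF has_derivative_linear[OF D]] by simp
  ultimately show ?thesis
    using pd_eqI[OF D, of i] by (simp add: has_pd_def has_field_derivative_def)
qed

lemma has_pd_const: "has_pd i (\<lambda>_. k) 0 p"
  by (simp add: has_pd_def)

lemma has_pd_component: "has_pd i (\<lambda>x. x $ j) (if i = j then 1 else 0) p"
  unfolding has_pd_def by (auto intro!: derivative_eq_intros simp: axis_def)

lemma has_pd_add:
  "has_pd i \<phi> d p \<Longrightarrow> has_pd i \<psi> e p \<Longrightarrow> has_pd i (\<lambda>x. \<phi> x + \<psi> x) (d + e) p"
  unfolding has_pd_def by (rule DERIV_add)

lemma has_pd_diff:
  "has_pd i \<phi> d p \<Longrightarrow> has_pd i \<psi> e p \<Longrightarrow> has_pd i (\<lambda>x. \<phi> x - \<psi> x) (d - e) p"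
  unfolding has_pd_def by (rule DERIV_diff)

lemma has_pd_minus: "has_pd i \<phi> d p \<Longrightarrow> has_pd i (\<lambda>x. - \<phi> x) (- d) p"
  unfolding has_pd_def by (rule DERIV_minus)

lemma has_pd_mult:
  "has_pd i \<phi> d p \<Longrightarrow> has_pd i \<psi> e p \<Longrightarrow> has_pd i (\<lambda>x. \<phi> x * \<psi> x) (d * \<psi> p + e * \<phi> p) p"
  unfolding has_pd_def by (drule (1) DERIV_mult) simp

lemma has_pd_divide:
  "has_pd i \<phi> d p \<Longrightarrow> has_pd i \<psi> e p \<Longrightarrow> \<psi> p \<noteq> 0 \<Longrightarrow>
    has_pd i (\<lambda>x. \<phi> x / \<psi> x) ((d * \<psi> p - \<phi> p * e) / (\<psi> p * \<psi> p)) p"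
  unfolding has_pd_def by (drule (1) DERIV_divide) simp_all

lemma has_pd_power:
  "has_pd i \<phi> d p \<Longrightarrow> has_pd i (\<lambda>x. \<phi> x ^ n) (of_nat n * (d * \<phi> p ^ (n - 1))) p"
  unfolding has_pd_def by (drule DERIV_power[where n = n]) simp

lemmas has_pd_intros = has_pd_const has_pd_component has_pd_add has_pd_diff has_pd_minus
  has_pd_mult has_pd_divide has_pd_power

lemma pd_const: "pd i (\<lambda>_. k) = (\<lambda>_. 0)"
  by (rule ext) (rule pd_eq[OF has_pd_const])

text \<open>Openness keeps a short coordinate segment through \<open>p\<close> inside
  \<open>U\<close>. This is what allows formulas valid only on a region to be
  differentiated.\<close>

lemma pd_cong:
  assumes "open U" "p \<in> U" "\<And>x. x \<in> U \<Longrightarrow> \<phi> x = \<psi> x"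
  shows "pd i \<phi> p = pd i \<psi> p"
proof -
  have "((\<lambda>h. p + h *\<^sub>R axis i 1) \<longlongrightarrow> p + 0 *\<^sub>R axis i 1) (nhds (0::real))"
    by (intro tendsto_intros filterlim_ident)
  hence "eventually (\<lambda>h. p + h *\<^sub>R axis i 1 \<in> U) (nhds (0::real))"
    using topological_tendstoD[of _ _ _ U] assms(1,2) by auto
  hence "eventually (\<lambda>h. \<phi> (p + h *\<^sub>R axis i 1) = \<psi> (p + h *\<^sub>R axis i 1)) (nhds 0)"
    by eventually_elim (rule assms(3))
  thus ?thesis unfolding pd_def by (intro deriv_cong_ev) auto
qed

section \<open>Symmetry of second partial derivatives\<close>

lemma DERIV_along_axis:
  assumes "\<phi> differentiable (at (p + s *\<^sub>R axis i 1))"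
  shows "((\<lambda>t. \<phi> (p + t *\<^sub>R axis i 1)) has_real_derivative pd i \<phi> (p + s *\<^sub>R axis i 1)) (at s)"
proof -
  have "((\<lambda>h. \<phi> (p + (h + s) *\<^sub>R axis i 1)) has_real_derivative pd i \<phi> (p + s *\<^sub>R axis i 1)) (at 0)"
    using has_pd_differentiable[OF assms, of i] unfolding has_pd_def
    by (simp add: scaleR_add_left add_ac)
  thus ?thesis
    using DERIV_shift[of "\<lambda>t. \<phi> (p + t *\<^sub>R axis i 1)" _ 0 s] by simp
qed

text \<open>The mean value theorem is applied twice: in direction \<open>i\<close> to the increment
  of \<open>\<phi>\<close> along \<open>j\<close>, then in direction \<open>j\<close> to
  \<open>pd i \<phi>\<close>. The second difference itself is symmetric in \<open>i\<close> and
  \<open>j\<close>, and the symmetry of mixed partials rests on that.\<close>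

lemma second_difference_mvt:
  fixes \<phi> :: "real^'n::finite \<Rightarrow> real"
  assumes h: "0 < h"
    and U: "\<And>s t. 0 \<le> s \<Longrightarrow> s \<le> h \<Longrightarrow> 0 \<le> t \<Longrightarrow> t \<le> h \<Longrightarrow> p + s *\<^sub>R axis i 1 + t *\<^sub>R axis j 1 \<in> U"
    and d1: "\<And>x. x \<in> U \<Longrightarrow> \<phi> differentiable (at x)"
    and d2: "\<And>x. x \<in> U \<Longrightarrow> pd i \<phi> differentiable (at x)"
  obtains s t where "0 < s" "s < h" "0 < t" "t < h"
    and "\<phi> (p + h *\<^sub>R axis i 1 + h *\<^sub>R axis j 1) - \<phi> (p + h *\<^sub>R axis i 1) - \<phi> (p + h *\<^sub>R axis j 1) + \<phi> p
      = h\<^sup>2 * pd j (pd i \<phi>) (p + s *\<^sub>R axis i 1 + t *\<^sub>R axis j 1)"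
proof -
  let ?d = "\<lambda>s. \<phi> ((p + h *\<^sub>R axis j 1) + s *\<^sub>R axis i 1) - \<phi> (p + s *\<^sub>R axis i 1)"
  let ?d' = "\<lambda>s. pd i \<phi> ((p + h *\<^sub>R axis j 1) + s *\<^sub>R axis i 1) - pd i \<phi> (p + s *\<^sub>R axis i 1)"
  have "(?d has_real_derivative ?d' s) (at s)" if "0 \<le> s" "s \<le> h" for s
    using U[OF that, of h] U[OF that, of 0] h
    by (intro DERIV_diff DERIV_along_axis d1) (simp_all add: add_ac)
  then obtain s where s: "0 < s" "s < h" "?d h - ?d 0 = (h - 0) * ?d' s"
    using MVT2[OF h, of ?d ?d'] by blast
  let ?e = "\<lambda>t. pd i \<phi> ((p + s *\<^sub>R axis i 1) + t *\<^sub>R axis j 1)"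
  have "(?e has_real_derivative pd j (pd i \<phi>) ((p + s *\<^sub>R axis i 1) + t *\<^sub>R axis j 1)) (at t)"
    if "0 \<le> t" "t \<le> h" for t
    using U[OF _ _ that, of s] s by (intro DERIV_along_axis d2) simp
  from MVT2[OF h, of ?e, OF this] obtain t where t: "0 < t" "t < h"
      "?e h - ?e 0 = (h - 0) * pd j (pd i \<phi>) ((p + s *\<^sub>R axis i 1) + t *\<^sub>R axis j 1)"
    by blast
  have "?d' s = ?e h - ?e 0" by (simp add: add_ac)
  hence "?d h - ?d 0 = h\<^sup>2 * pd j (pd i \<phi>) ((p + s *\<^sub>R axis i 1) + t *\<^sub>R axis j 1)"
    using s(3) t(3) by (simp add: power2_eq_square)
  thus ?thesis by (intro that[OF s(1,2) t(1,2)]) (simp add: add_ac)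
qed

lemma pd_commute:
  fixes \<phi> :: "real^'n::finite \<Rightarrow> real"
  assumes "open U" "p \<in> U" "Ck_on 2 U \<phi>"
  shows "pd i (pd j \<phi>) p = pd j (pd i \<phi>) p"
proof (rule ccontr)
  let ?a = "pd i (pd j \<phi>)" and ?b = "pd j (pd i \<phi>)"
  assume neq: "?a p \<noteq> ?b p"
  \<comment> \<open>Half the supposed gap: no common value lies within \<open>\<epsilon>\<close> of
    both \<open>?a p\<close> and \<open>?b p\<close>.\<close>
  define \<epsilon> where "\<epsilon> = \<bar>?a p - ?b p\<bar> / 2"
  have \<epsilon>: "\<epsilon> > 0" using neq by (simp add: \<epsilon>_def)
  have Ck: "Ck_on (Suc (Suc 0)) U \<phi>" using assms(3) by (simp add: numeral_2_eq_2)
  hence d1: "\<And>x. x \<in> U \<Longrightarrow> \<phi> differentiable (at x)"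
    and d2: "\<And>x k. x \<in> U \<Longrightarrow> pd k \<phi> differentiable (at x)"
    and cont: "\<And>k l. continuous_on U (pd k (pd l \<phi>))" by auto
  have near: "\<exists>\<delta>>0. \<forall>x. dist x p < \<delta> \<longrightarrow> dist (pd k (pd l \<phi>) x) (pd k (pd l \<phi>) p) < \<epsilon>" for k l
    using cont[of k l] assms(1,2) \<epsilon>
    by (simp add: continuous_on_eq_continuous_at continuous_at_eps_delta)
  obtain \<delta>1 where \<delta>1: "\<delta>1 > 0" "\<And>x. dist x p < \<delta>1 \<Longrightarrow> dist (?a x) (?a p) < \<epsilon>" using near by blast
  obtain \<delta>2 where \<delta>2: "\<delta>2 > 0" "\<And>x. dist x p < \<delta>2 \<Longrightarrow> dist (?b x) (?b p) < \<epsilon>" using near by blast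
  obtain \<delta>3 where \<delta>3: "\<delta>3 > 0" "ball p \<delta>3 \<subseteq> U" using assms(1,2) openE by blast
  \<comment> \<open>The sampled points lie within \<open>2 * h\<close> of \<open>p\<close>; a third
    of the smallest radius puts \<open>2 * h\<close> strictly below all three.\<close>
  define h where "h = min \<delta>1 (min \<delta>2 \<delta>3) / 3"
  have h: "h > 0" "2 * h < \<delta>1" "2 * h < \<delta>2" "2 * h < \<delta>3"
    using \<delta>1(1) \<delta>2(1) \<delta>3(1) by (auto simp: h_def)
  have close: "dist (p + s *\<^sub>R axis k 1 + t *\<^sub>R axis l 1) p \<le> 2 * h"
    if "0 \<le> s" "s \<le> h" "0 \<le> t" "t \<le> h" for s t k l
  proof -
    have "norm (s *\<^sub>R axis k 1 + t *\<^sub>R axis l 1 :: real^'n) \<le> \<bar>s\<bar> + \<bar>t\<bar>"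
      by (rule order_trans[OF norm_triangle_ineq]) (simp add: norm_axis_1)
    thus ?thesis using that by (simp add: dist_norm add.assoc)
  qed
  have inU: "p + s *\<^sub>R axis k 1 + t *\<^sub>R axis l 1 \<in> U"
    if "0 \<le> s" "s \<le> h" "0 \<le> t" "t \<le> h" for s t k l
    using close[OF that, of k l] h(4) \<delta>3(2) by (auto simp: dist_commute subset_iff)
  obtain s t where st: "0 < s" "s < h" "0 < t" "t < h"
    "\<phi> (p + h *\<^sub>R axis i 1 + h *\<^sub>R axis j 1) - \<phi> (p + h *\<^sub>R axis i 1) - \<phi> (p + h *\<^sub>R axis j 1) + \<phi> p
      = h\<^sup>2 * ?b (p + s *\<^sub>R axis i 1 + t *\<^sub>R axis j 1)"
    by (rule second_difference_mvt[OF h(1) inU d1 d2])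
  obtain s' t' where st': "0 < s'" "s' < h" "0 < t'" "t' < h"
    "\<phi> (p + h *\<^sub>R axis j 1 + h *\<^sub>R axis i 1) - \<phi> (p + h *\<^sub>R axis j 1) - \<phi> (p + h *\<^sub>R axis i 1) + \<phi> p
      = h\<^sup>2 * ?a (p + s' *\<^sub>R axis j 1 + t' *\<^sub>R axis i 1)"
    by (rule second_difference_mvt[OF h(1) inU d1 d2])
  have "h\<^sup>2 * ?a (p + s' *\<^sub>R axis j 1 + t' *\<^sub>R axis i 1) = h\<^sup>2 * ?b (p + s *\<^sub>R axis i 1 + t *\<^sub>R axis j 1)"
    unfolding st(5)[symmetric] st'(5)[symmetric]
    by (simp add: add.assoc add.commute[of "h *\<^sub>R axis j 1"])
  \<comment> \<open>Both second differences are the same number, so the two mixed partials take a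
    common value at points near \<open>p\<close>.\<close>
  hence eq: "?a (p + s' *\<^sub>R axis j 1 + t' *\<^sub>R axis i 1) = ?b (p + s *\<^sub>R axis i 1 + t *\<^sub>R axis j 1)"
    using h(1) by simp
  have "dist (?a (p + s' *\<^sub>R axis j 1 + t' *\<^sub>R axis i 1)) (?a p) < \<epsilon>"
    using close[of s' t' j i] st' h by (intro \<delta>1(2)) linarith
  moreover have "dist (?b (p + s *\<^sub>R axis i 1 + t *\<^sub>R axis j 1)) (?b p) < \<epsilon>"
    using close[of s t i j] st h by (intro \<delta>2(2)) linarith
  ultimately show False unfolding eq dist_real_def \<epsilon>_def
    by (auto simp: abs_if field_simps split: if_splits)
qed

lemma smooth_on_const: "smooth_on U (\<lambda>_. k)"
proof -
  have "Ck_on n U (\<lambda>_. k)" for n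
    by (induction n arbitrary: k) (auto simp: pd_const)
  thus ?thesis by (simp add: smooth_on_def)
qed

text \<open>Makes the coordinate fields admissible test fields in the tensor conditions, so that
  component equations can be extracted from them.\<close>

lemma smooth_vfield_coord_field: "smooth_vfield_on U (coord_field i)"
  unfolding smooth_vfield_on_def coord_field_def by (simp add: smooth_on_const)

section \<open>Connection and curvature in coordinates\<close>

text \<open>For square matrices a right inverse is two-sided, and inverses are unique.\<close>

lemma matrix_inv_eqI:
  fixes A B :: "real^'n^'n"
  assumes "A ** B = mat 1"
  shows "matrix_inv A = B"
proof -
  have BA: "B ** A = mat 1" using assms matrix_left_right_inverse by blast
  have "A ** matrix_inv A = mat 1 \<and> matrix_inv A ** A = mat 1"
    unfolding matrix_inv_def by (rule someI[of _ B]) (use assms BA in auto)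
  thus ?thesis by (metis BA matrix_mul_assoc matrix_mul_lid matrix_mul_rid)
qed

lemma vf_apply_coord_field: "vf_apply (coord_field i) \<phi> p = pd i \<phi> p"
  by (simp add: vf_apply_def coord_field_def axis_def if_distrib[of "\<lambda>x. x * _"] cong: if_cong)

text \<open>The second argument stays arbitrary because the curvature operator nests covariant
  derivatives, and the inner one is in general no coordinate field.\<close>

lemma levi_civita_coord_field_left:
  "levi_civita g (coord_field i) Y p $ k
    = pd i (\<lambda>x. Y x $ k) p + (\<Sum>m\<in>UNIV. christoffel g k i m p * Y p $ m)"
proof -
  have "(\<Sum>l\<in>UNIV. \<Sum>m\<in>UNIV. christoffel g k l m p * coord_field i p $ l * Y p $ m)
      = (\<Sum>m\<in>UNIV. christoffel g k i m p * Y p $ m)"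
    by (subst sum.swap)
      (simp add: coord_field_def axis_def if_distrib[of "\<lambda>x. _ * x * _"] cong: if_cong)
  thus ?thesis by (simp add: levi_civita_def vf_apply_coord_field)
qed

lemma levi_civita_coord_fields:
  "levi_civita g (coord_field i) (coord_field j) p $ k = christoffel g k i j p"
  unfolding levi_civita_coord_field_left
  by (simp add: coord_field_def pd_const axis_def if_distrib[of "\<lambda>x. _ * x"] cong: if_cong)

lemma tensor_eval_coord_field_left:
  "tensor_eval T (coord_field i) Y p = (\<Sum>j\<in>UNIV. T p $ i $ j * Y p $ j)"
  unfolding tensor_eval_def
  by (subst sum.swap) (simp add: coord_field_def axis_def if_distrib[of "\<lambda>x. _ * x * _"] cong: if_cong)

lemma tensor_eval_coord_field_right:
  "tensor_eval T X (coord_field j) p = (\<Sum>i\<in>UNIV. T p $ i $ j * X p $ i)"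
  unfolding tensor_eval_def
  by (simp add: coord_field_def axis_def if_distrib[of "\<lambda>x. _ * x"] cong: if_cong)

lemma tensor_eval_coord_fields:
  "tensor_eval T (coord_field i) (coord_field j) = (\<lambda>p. T p $ i $ j)"
  unfolding tensor_eval_coord_field_right fun_eq_iff
  by (simp add: coord_field_def axis_def if_distrib[of "\<lambda>x. _ * x"] cong: if_cong)

lemma cov_deriv_coord_fields:
  "cov_deriv g T (coord_field k) (coord_field i) (coord_field j) p = pd k (\<lambda>x. T x $ i $ j) p
     - (\<Sum>m\<in>UNIV. T p $ m $ j * christoffel g m k i p) - (\<Sum>m\<in>UNIV. T p $ i $ m * christoffel g m k j p)"
  unfolding cov_deriv_def vf_apply_coord_field tensor_eval_coord_fields
    tensor_eval_coord_field_left tensor_eval_coord_field_right levi_civita_coord_fields ..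

text \<open>Coordinate fields commute, so the bracket term drops out.\<close>

lemma curvature_op_coord_fields:
  "curvature_op g (coord_field i) (coord_field j) (coord_field k) p $ l =
     pd j (\<lambda>x. christoffel g l i k x) p - pd i (\<lambda>x. christoffel g l j k x) p
     + (\<Sum>m\<in>UNIV. christoffel g l j m p * christoffel g m i k p - christoffel g l i m p * christoffel g m j k p)"
proof -
  have "lie_bracket (coord_field i) (coord_field j) = (\<lambda>_. 0)"
    by (simp add: fun_eq_iff vec_eq_iff lie_bracket_def vf_apply_coord_field)
      (simp add: coord_field_def pd_const)
  hence "levi_civita g (lie_bracket (coord_field i) (coord_field j)) (coord_field k) p = 0"
    by (simp add: vec_eq_iff levi_civita_def vf_apply_def)
  thus ?thesis
    unfolding curvature_op_def
    by (simp add: levi_civita_coord_field_left[where Y = "levi_civita _ _ _"]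
        levi_civita_coord_fields sum_subtractf)
qed

text \<open>Lowering the last index with \<open>g\<close> and contracting it with the inverse metric
  cancel, which leaves the trace of the curvature operator over its first argument. Ricci components
  then come straight from the Christoffel symbols.\<close>

lemma ricci_eq_christoffel:
  fixes g :: "'n::finite tensor2"
  assumes "invertible (g p)" and "transpose (g p) = g p"
  shows "ricci g p $ j $ k = (\<Sum>i\<in>UNIV. pd j (\<lambda>x. christoffel g i i k x) p - pd i (\<lambda>x. christoffel g i j k x) p
     + (\<Sum>m\<in>UNIV. christoffel g i j m p * christoffel g m i k p - christoffel g i i m p * christoffel g m j k p))"
proof -
  let ?R = "\<lambda>i. curvature_op g (coord_field i) (coord_field j) (coord_field k) p"
  have sym: "g p $ m $ l = g p $ l $ m" for m l
    using arg_cong[OF assms(2), of "\<lambda>A. A $ l $ m"] by (simp add: transpose_def)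
  have "matrix_inv (g p) ** g p = mat 1"
    using assms(1) unfolding invertible_def matrix_inv_def by (rule someI2_ex) auto
  hence inv: "(\<Sum>l\<in>UNIV. matrix_inv (g p) $ i $ l * g p $ l $ m) = (if i = m then 1 else 0)" for m i
    unfolding matrix_matrix_mult_def mat_def by (simp add: vec_eq_iff)
  have contract: "(\<Sum>l\<in>UNIV. matrix_inv (g p) $ i $ l * (\<Sum>m\<in>UNIV. g p $ m $ l * ?R i $ m)) = ?R i $ i" for i
  proof -
    have "(\<Sum>l\<in>UNIV. matrix_inv (g p) $ i $ l * (\<Sum>m\<in>UNIV. g p $ m $ l * ?R i $ m))
        = (\<Sum>m\<in>UNIV. (\<Sum>l\<in>UNIV. matrix_inv (g p) $ i $ l * g p $ l $ m) * ?R i $ m)"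
      unfolding sum_distrib_left sum_distrib_right
      by (subst sum.swap) (simp add: sym mult.assoc)
    also have "\<dots> = ?R i $ i" by (simp add: inv mult_delta_left)
    finally show ?thesis .
  qed
  have "ricci g p $ j $ k = (\<Sum>i\<in>UNIV. ?R i $ i)"
    by (simp add: ricci_def riemann_def tensor_eval_coord_field_right contract)
  thus ?thesis by (simp add: curvature_op_coord_fields)
qed

lemma smooth_on_imp_differentiable:
  assumes "smooth_on U \<phi>" "p \<in> U"
  shows "\<phi> differentiable (at p)"
proof -
  have "Ck_on (Suc 0) U \<phi>" using assms(1) by (simp only: smooth_on_def)
  thus ?thesis using assms(2) by simp
qed

text \<open>The constant \<open>k\<close> passes through the derivative. The relation is assumed on
  a neighbourhood because \<open>vf_apply\<close> differentiates \<open>T'\<close>.\<close>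

lemma cov_deriv_scaleR:
  fixes g T T' :: "'n::finite tensor2"
  assumes "open U" "p \<in> U" and T': "\<And>x. x \<in> U \<Longrightarrow> T' x = k *\<^sub>R T x"
    and dT: "\<And>i j. (\<lambda>x. T x $ i $ j) differentiable (at p)"
    and dY: "\<And>i. (\<lambda>x. Y x $ i) differentiable (at p)"
    and dZ: "\<And>i. (\<lambda>x. Z x $ i) differentiable (at p)"
  shows "cov_deriv g T' X Y Z p = k * cov_deriv g T X Y Z p"
proof -
  have eval: "tensor_eval T' V W x = k * tensor_eval T V W x" if "x \<in> U" for V W x
    by (simp add: tensor_eval_def T'[OF that] sum_distrib_left mult.assoc)
  have "tensor_eval T Y Z differentiable (at p)"
    unfolding tensor_eval_def[abs_def]
    by (intro differentiable_sum finite ballI differentiable_mult dT dY dZ)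
  hence pdT: "has_pd m (tensor_eval T Y Z) (pd m (tensor_eval T Y Z) p) p" for m
    by (rule has_pd_differentiable)
  have "pd m (tensor_eval T' Y Z) p = pd m (\<lambda>x. k * tensor_eval T Y Z x) p" for m
    by (rule pd_cong[OF assms(1,2) eval])
  also have "\<dots> m = k * pd m (tensor_eval T Y Z) p" for m
    by (rule pd_eq, rule has_pd_rhs, rule has_pd_mult[OF has_pd_const pdT]) simp
  finally have "vf_apply X (tensor_eval T' Y Z) p = k * vf_apply X (tensor_eval T Y Z) p"
    by (simp add: vf_apply_def sum_distrib_left algebra_simps)
  thus ?thesis
    by (simp add: cov_deriv_def eval[OF assms(2)] algebra_simps)
qed

section \<open>The Robinson-Trautman metric\<close>

lemma proj34_add_axis:
  "proj34 (p + h *\<^sub>R axis 1 1) = proj34 p" "proj34 (p + h *\<^sub>R axis 2 1) = proj34 p"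
  "proj34 (p + h *\<^sub>R axis 3 1) = proj34 p + h *\<^sub>R axis 1 1"
  "proj34 (p + h *\<^sub>R axis 4 1) = proj34 p + h *\<^sub>R axis 2 1"
  by (simp_all add: proj34_def vec_eq_iff forall_2 axis_def vector_2)

lemma linear_proj34: "linear proj34"
  by (rule linearI) (simp_all add: proj34_def vec_eq_iff forall_2 vector_2)

text \<open>Second partials of \<open>f\<close> have to commute on the projection of
  \<open>M\<close>, and \<open>pd_commute\<close> asks for an open set.\<close>

lemma open_proj34_image:
  assumes "open M"
  shows "open (proj34 ` M)"
proof (rule open_surjective_linear_image[OF assms linear_proj34])
  show "surj proj34"
  proof (rule surjI)
    fix x :: "real^2"
    show "proj34 (vector [0, 0, x $ 1, x $ 2]) = x"
      by (simp add: proj34_def vec_eq_iff forall_2 vector_2 vector_4)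
  qed
qed

text \<open>Shifting \<open>t\<close> or \<open>r\<close> does not move the projected point, and
  axes 3 and 4 become axes 1 and 2 of the plane.\<close>

lemma has_pd_proj34:
  assumes "\<phi> differentiable (at (proj34 p))"
  shows "has_pd m (\<lambda>x. \<phi> (proj34 x))
    (if m = 3 then pd 1 \<phi> (proj34 p) else if m = 4 then pd 2 \<phi> (proj34 p) else 0) p"
proof -
  have "m = 1 \<or> m = 2 \<or> m = 3 \<or> m = 4" by (rule exhaust_4)
  thus ?thesis
    using has_pd_differentiable[OF assms, of 1] has_pd_differentiable[OF assms, of 2]
    by (auto simp: has_pd_def proj34_add_axis)
qed

section \<open>The region and the functions entering the metric coefficients\<close>

locale robinson_trautman_region =
  fixes a b q :: real and f :: "real^2 \<Rightarrow> real" and M :: "(real^4) set"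
  assumes open_M: "open M"
    and r_nonzero: "\<And>p. p \<in> M \<Longrightarrow> p $ 2 \<noteq> 0"
    and smooth_f: "smooth_on (proj34 ` M) f"
    and f_nonzero: "\<And>x. x \<in> proj34 ` M \<Longrightarrow> f x \<noteq> 0"
begin

abbreviation g :: "4 tensor2" where "g \<equiv> robinson_trautman a b q f"

text \<open>\<open>f\<close> and its partials up to order two, pulled back to spacetime. The
  derivatives of \<open>u\<close>, \<open>u3\<close> and \<open>u4\<close> are again among these
  functions, so metric and connection coefficients can be differentiated mechanically.\<close>

definition u where "u p = f (proj34 p)"
definition u3 where "u3 p = pd 1 f (proj34 p)"
definition u4 where "u4 p = pd 2 f (proj34 p)"
definition u33 where "u33 p = pd 1 (pd 1 f) (proj34 p)"
definition u34 where "u34 p = pd 1 (pd 2 f) (proj34 p)"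
definition u44 where "u44 p = pd 2 (pd 2 f) (proj34 p)"
text \<open>The coefficient of \<open>dt^2\<close>; \<open>A'\<close> is its derivative in
  \<open>r\<close>.\<close>

definition A :: "real^4 \<Rightarrow> real" where "A p = - 2 * (a - 2 * b * p $ 2 - q / p $ 2)"
definition A' :: "real^4 \<Rightarrow> real" where "A' p = 4 * b - 2 * q / (p $ 2)\<^sup>2"

lemma u_nonzero: "p \<in> M \<Longrightarrow> u p \<noteq> 0"
  using f_nonzero by (simp add: u_def)

lemma differentiable_f:
  assumes "p \<in> M"
  shows "f differentiable (at (proj34 p))" "pd i f differentiable (at (proj34 p))"
proof -
  have "Ck_on (Suc (Suc 0)) (proj34 ` M) f" using smooth_f by (simp only: smooth_on_def)
  thus "f differentiable (at (proj34 p))" "pd i f differentiable (at (proj34 p))"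
    using assms by auto
qed

lemma has_pd_u: "p \<in> M \<Longrightarrow> has_pd m u (if m = 3 then u3 p else if m = 4 then u4 p else 0) p"
  unfolding u_def[abs_def] u3_def u4_def by (intro has_pd_proj34 differentiable_f)

lemma has_pd_u3: "p \<in> M \<Longrightarrow> has_pd m u3 (if m = 3 then u33 p else if m = 4 then u34 p else 0) p"
proof -
  assume p: "p \<in> M"
  have "Ck_on 2 (proj34 ` M) f" using smooth_f by (simp only: smooth_on_def)
  \<comment> \<open>The \<open>x^4\<close>-derivative of \<open>u3\<close> is
    \<open>pd 2 (pd 1 f)\<close>, whereas \<open>u34\<close> is taken in the other order.\<close>
  hence "pd 1 (pd 2 f) (proj34 p) = pd 2 (pd 1 f) (proj34 p)"
    by (rule pd_commute[OF open_proj34_image[OF open_M] imageI[OF p]])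
  thus ?thesis
    unfolding u3_def[abs_def] u33_def u34_def
    using has_pd_proj34[OF differentiable_f(2)[OF p]] by metis
qed

lemma has_pd_u4: "p \<in> M \<Longrightarrow> has_pd m u4 (if m = 3 then u34 p else if m = 4 then u44 p else 0) p"
  unfolding u4_def[abs_def] u34_def u44_def by (intro has_pd_proj34 differentiable_f)

lemma has_pd_A: "p \<in> M \<Longrightarrow> has_pd m A (if m = 2 then A' p else 0) p"
  unfolding A_def[abs_def] A'_def
  by (rule has_pd_rhs, (rule has_pd_intros)+)
    (use r_nonzero in \<open>auto simp: field_simps power2_eq_square\<close>)

lemma has_pd_A': "p \<in> M \<Longrightarrow> has_pd m A' (if m = 2 then 4 * q / (p $ 2) ^ 3 else 0) p"
  unfolding A'_def[abs_def]
  by (rule has_pd_rhs, (rule has_pd_intros)+)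
    (use r_nonzero in \<open>auto simp: field_simps power2_eq_square power3_eq_cube\<close>)

lemmas has_pd_rules = has_pd_u has_pd_u3 has_pd_u4 has_pd_A has_pd_A' has_pd_intros

section \<open>Inverse metric and Christoffel symbols\<close>

lemma g_eq: "g p = vector [vector [A p, 1, 0, 0], vector [1, 0, 0, 0],
    vector [0, 0, - (p $ 2 / u p)\<^sup>2, 0], vector [0, 0, 0, - (p $ 2 / u p)\<^sup>2]]"
  by (simp add: robinson_trautman_def Let_def A_def u_def power_divide)

lemma g_sym: "transpose (g p) = g p"
  by (simp add: vec_eq_iff forall_4 transpose_def g_eq vector_4)

text \<open>Inverted blockwise: the \<open>(t, r)\<close> block has determinant \<open>-1\<close>,
  the other block is diagonal.\<close>

definition ginv :: "4 tensor2" where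
  "ginv p = vector [vector [0, 1, 0, 0], vector [1, - A p, 0, 0],
    vector [0, 0, - (u p / p $ 2)\<^sup>2, 0], vector [0, 0, 0, - (u p / p $ 2)\<^sup>2]]"

lemma g_ginv: "p \<in> M \<Longrightarrow> g p ** ginv p = mat 1"
  using r_nonzero[of p] u_nonzero[of p]
  by (simp add: vec_eq_iff forall_4 matrix_matrix_mult_def g_eq ginv_def vector_4 sum_4 mat_def
      power_divide)

lemma matrix_inv_g: "p \<in> M \<Longrightarrow> matrix_inv (g p) = ginv p"
  by (rule matrix_inv_eqI[OF g_ginv])

lemma invertible_g: "p \<in> M \<Longrightarrow> invertible (g p)"
  using g_ginv matrix_left_right_inverse unfolding invertible_def by blast

text \<open>Table of the Christoffel symbols; the outermost index is the upper one. The entries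
  \<open>1 / p $ 2\<close> stem from the factor \<open>r^2\<close> of the fibre metric, those with
  \<open>u3\<close> and \<open>u4\<close> from its conformal factor \<open>1 / u^2\<close>.\<close>

definition \<Gamma> :: "real^4 \<Rightarrow> real^4^4^4" where
  "\<Gamma> p = vector [
    vector [vector [- (A' p / 2), 0, 0, 0],
            vector [0, 0, 0, 0],
            vector [0, 0, p $ 2 / (u p)\<^sup>2, 0],
            vector [0, 0, 0, p $ 2 / (u p)\<^sup>2]],
    vector [vector [A p * A' p / 2, A' p / 2, 0, 0],
            vector [A' p / 2, 0, 0, 0],
            vector [0, 0, - (A p * p $ 2 / (u p)\<^sup>2), 0],
            vector [0, 0, 0, - (A p * p $ 2 / (u p)\<^sup>2)]],
    vector [vector [0, 0, 0, 0],
            vector [0, 0, 1 / p $ 2, 0],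
            vector [0, 1 / p $ 2, - (u3 p / u p), - (u4 p / u p)],
            vector [0, 0, - (u4 p / u p), u3 p / u p]],
    vector [vector [0, 0, 0, 0],
            vector [0, 0, 0, 1 / p $ 2],
            vector [0, 0, u4 p / u p, - (u3 p / u p)],
            vector [0, 1 / p $ 2, - (u3 p / u p), - (u4 p / u p)]]]"

lemma pd_fibre_coeff:
  assumes "p \<in> M"
  shows "pd m (\<lambda>x. - (x $ 2 / u x)\<^sup>2) p = (if m = 2 then - 2 * p $ 2 / (u p)\<^sup>2 else
    if m = 3 then 2 * (p $ 2)\<^sup>2 * u3 p / (u p)^3 else
    if m = 4 then 2 * (p $ 2)\<^sup>2 * u4 p / (u p)^3 else 0)"
  by (rule pd_eq, rule has_pd_rhs, (rule has_pd_rules assms)+)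
    (use u_nonzero[OF assms] in \<open>auto simp: field_simps power2_eq_square power3_eq_cube\<close>)

lemma pd_A: "p \<in> M \<Longrightarrow> pd m A p = (if m = 2 then A' p else 0)"
  by (rule pd_eq[OF has_pd_A])

lemma christoffel_g:
  assumes "p \<in> M"
  shows "christoffel g k i j p = \<Gamma> p $ k $ i $ j"
proof -
  have "\<forall>k i j. christoffel g k i j p = \<Gamma> p $ k $ i $ j"
    unfolding christoffel_def matrix_inv_g[OF assms]
    unfolding g_eq ginv_def
    using u_nonzero[OF assms] r_nonzero[OF assms]
    by (simp add: forall_4 sum_4 vector_4 pd_const pd_fibre_coeff[OF assms] pd_A[OF assms] \<Gamma>_def)
      (simp add: field_simps power2_eq_square power3_eq_cube)
  thus ?thesis by blast
qed

text \<open>Covers every nonconstant entry of \<open>\<Gamma>\<close>, with left sides written as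
  they occur there, signs included, so that they rewrite in the Ricci computation.\<close>

lemma pd_\<Gamma>_entries:
  assumes "p \<in> M"
  shows "pd m (\<lambda>x. A' x / 2) p = (if m = 2 then 2 * q / (p $ 2) ^ 3 else 0)"
    and "pd m (\<lambda>x. - (A' x / 2)) p = (if m = 2 then - 2 * q / (p $ 2) ^ 3 else 0)"
    and "pd m (\<lambda>x. A x * A' x / 2) p
      = (if m = 2 then (A' p)\<^sup>2 / 2 + 2 * q * A p / (p $ 2) ^ 3 else 0)"
    and "pd m (\<lambda>x. x $ 2 / (u x)\<^sup>2) p = (if m = 2 then 1 / (u p)\<^sup>2 else
      if m = 3 then - 2 * p $ 2 * u3 p / (u p) ^ 3 else
      if m = 4 then - 2 * p $ 2 * u4 p / (u p) ^ 3 else 0)"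
    and "pd m (\<lambda>x. - (A x * x $ 2 / (u x)\<^sup>2)) p = (if m = 2 then - (A' p * p $ 2 + A p) / (u p)\<^sup>2 else
      if m = 3 then 2 * A p * p $ 2 * u3 p / (u p) ^ 3 else
      if m = 4 then 2 * A p * p $ 2 * u4 p / (u p) ^ 3 else 0)"
    and "pd m (\<lambda>x. 1 / x $ 2) p = (if m = 2 then - 1 / (p $ 2)\<^sup>2 else 0)"
    and "pd m (\<lambda>x. u3 x / u x) p = (if m = 3 then (u33 p * u p - (u3 p)\<^sup>2) / (u p)\<^sup>2 else
      if m = 4 then (u34 p * u p - u3 p * u4 p) / (u p)\<^sup>2 else 0)"
    and "pd m (\<lambda>x. - (u3 x / u x)) p = (if m = 3 then - (u33 p * u p - (u3 p)\<^sup>2) / (u p)\<^sup>2 else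
      if m = 4 then - (u34 p * u p - u3 p * u4 p) / (u p)\<^sup>2 else 0)"
    and "pd m (\<lambda>x. u4 x / u x) p = (if m = 3 then (u34 p * u p - u3 p * u4 p) / (u p)\<^sup>2 else
      if m = 4 then (u44 p * u p - (u4 p)\<^sup>2) / (u p)\<^sup>2 else 0)"
    and "pd m (\<lambda>x. - (u4 x / u x)) p = (if m = 3 then - (u34 p * u p - u3 p * u4 p) / (u p)\<^sup>2 else
      if m = 4 then - (u44 p * u p - (u4 p)\<^sup>2) / (u p)\<^sup>2 else 0)"
  by (rule pd_eq, rule has_pd_rhs,
      (rule has_pd_rules assms power_not_zero zero_neq_numeral[symmetric] u_nonzero r_nonzero)+,
      (auto simp: u_nonzero[OF assms] r_nonzero[OF assms] field_simps power2_eq_square power3_eq_cube)[1])+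

section \<open>Curvature and energy-momentum tensor of the metric\<close>

lemma pd_christoffel_g:
  "p \<in> M \<Longrightarrow> pd m (christoffel g k i j) p = pd m (\<lambda>x. \<Gamma> x $ k $ i $ j) p"
  using christoffel_g by (intro pd_cong[OF open_M]) auto

lemma RT_F_proj34: "RT_F f (proj34 p) = (u3 p)\<^sup>2 + (u4 p)\<^sup>2 - u p * (u33 p + u44 p)"
  by (simp add: RT_F_def u_def u3_def u4_def u33_def u44_def)

text \<open>\<open>q\<close> cancels because \<open>A + r A' = -2a + 8br\<close> and
  \<open>A''/2 + A'/r = 4b/r\<close>. The \<open>(t, r)\<close> block is \<open>-4b/r\<close> times
  that of \<open>g\<close>, the other block \<open>(2a - 8br - F)/r^2\<close> times.\<close>

lemma ricci_g:
  assumes "p \<in> M"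
  shows "ricci g p = vector [
    vector [- 4 * b * A p / p $ 2, - 4 * b / p $ 2, 0, 0],
    vector [- 4 * b / p $ 2, 0, 0, 0],
    vector [0, 0, - (2 * a - 8 * b * p $ 2 - RT_F f (proj34 p)) / (u p)\<^sup>2, 0],
    vector [0, 0, 0, - (2 * a - 8 * b * p $ 2 - RT_F f (proj34 p)) / (u p)\<^sup>2]]"
proof -
  have *: "ricci g p $ j $ k = (\<Sum>i\<in>UNIV. pd j (\<lambda>x. \<Gamma> x $ i $ i $ k) p - pd i (\<lambda>x. \<Gamma> x $ i $ j $ k) p
     + (\<Sum>m\<in>UNIV. \<Gamma> p $ i $ j $ m * \<Gamma> p $ m $ i $ k - \<Gamma> p $ i $ i $ m * \<Gamma> p $ m $ j $ k))" for j k
    unfolding ricci_eq_christoffel[where g = g, OF invertible_g[OF assms] g_sym]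
    by (simp add: christoffel_g assms pd_christoffel_g)
  show ?thesis
    unfolding vec_eq_iff forall_4 *
    using u_nonzero[OF assms] r_nonzero[OF assms]
    \<comment> \<open>\<open>A\<close> and \<open>A'\<close> stay opaque while the derivatives are
      inserted; only their expansion afterwards makes \<open>q\<close> cancel.\<close>
    by (simp add: sum_4 \<Gamma>_def vector_4 pd_const pd_\<Gamma>_entries[OF assms] RT_F_proj34)
      (simp add: A_def A'_def field_simps power2_eq_square power3_eq_cube)
qed

lemma scalar_curvature_g:
  assumes "p \<in> M"
  shows "scalar_curvature g p = (4 * a - 24 * b * p $ 2 - 2 * RT_F f (proj34 p)) / (p $ 2)\<^sup>2"
  unfolding scalar_curvature_def matrix_inv_g[OF assms] ricci_g[OF assms]
  using u_nonzero[OF assms] r_nonzero[OF assms]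
  by (simp add: sum_4 vector_4 ginv_def field_simps power2_eq_square)

text \<open>The factor of the \<open>(t, r)\<close> block of \<open>g\<close> in \<open>T\<close>,
  up to the physical constant. In the factor \<open>\<Lambda> + 4b/r\<close> of the other block,
  \<open>F\<close> cancels between \<open>ricci\<close> and \<open>scalar_curvature\<close>.\<close>

definition T_base :: "real \<Rightarrow> real^4 \<Rightarrow> real" where
  "T_base \<Lambda> p = \<Lambda> - (2 * a - 8 * b * p $ 2 - RT_F f (proj34 p)) / (p $ 2)\<^sup>2"

lemma energy_momentum_g:
  assumes "p \<in> M"
  shows "energy_momentum c G \<Lambda> g p = (c ^ 4 / (8 * pi * G)) *\<^sub>R vector [
    vector [T_base \<Lambda> p * A p, T_base \<Lambda> p, 0, 0],
    vector [T_base \<Lambda> p, 0, 0, 0],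
    vector [0, 0, - ((\<Lambda> + 4 * b / p $ 2) * (p $ 2 / u p)\<^sup>2), 0],
    vector [0, 0, 0, - ((\<Lambda> + 4 * b / p $ 2) * (p $ 2 / u p)\<^sup>2)]]"
  unfolding energy_momentum_def scalar_curvature_g[OF assms] ricci_g[OF assms] g_eq
  using u_nonzero[OF assms] r_nonzero[OF assms]
  by (intro arg_cong[where f = "scaleR _"])
    (simp add: vec_eq_iff forall_4 vector_4 T_base_def field_simps power2_eq_square)

text \<open>As \<open>g\<close> is parallel, only the two block factors contribute. Up to
  \<open>K\<close>, the first component is the \<open>r\<close>-derivative of
  \<open>\<Lambda> + 4b/r\<close> times the \<open>(3, 3)\<close> entry of \<open>g\<close>. The
  other two are \<open>r/u^2\<close> times the fibre factor minus \<open>T_base\<close>, through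
  \<open>\<Gamma> p $ 3 $ 3 $ 2\<close> and \<open>\<Gamma> p $ 1 $ 3 $ 3\<close>.\<close>

lemma cov_deriv_energy_momentum:
  fixes c G \<Lambda> :: real
  assumes "p \<in> M"
  defines "K \<equiv> c ^ 4 / (8 * pi * G)"
    and "D \<equiv> \<lambda>k i j. cov_deriv g (energy_momentum c G \<Lambda> g) (coord_field k) (coord_field i) (coord_field j) p"
  shows "D 2 3 3 = K / (u p)\<^sup>2 * (4 * b)"
    and "D 3 2 3 = K / (u p)\<^sup>2 * ((2 * a - 4 * b * p $ 2 - RT_F f (proj34 p)) / p $ 2)"
    and "D 3 3 2 = K / (u p)\<^sup>2 * ((2 * a - 4 * b * p $ 2 - RT_F f (proj34 p)) / p $ 2)"
proof -
  let ?T = "energy_momentum c G \<Lambda> g"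
  have "pd 2 (\<lambda>x. ?T x $ 3 $ 3) p = pd 2 (\<lambda>x. K * - ((\<Lambda> + 4 * b / x $ 2) * (x $ 2 / u x)\<^sup>2)) p"
    by (rule pd_cong[OF open_M assms(1)]) (simp add: energy_momentum_g vector_4 K_def)
  also have "\<dots> = - 2 * K * (\<Lambda> + 4 * b / p $ 2) * p $ 2 / (u p)\<^sup>2 + 4 * K * b / (u p)\<^sup>2"
    by (rule pd_eq, rule has_pd_rhs,
      (rule has_pd_rules assms power_not_zero u_nonzero r_nonzero)+,
      (auto simp: u_nonzero[OF assms(1)] r_nonzero[OF assms(1)] field_simps power2_eq_square))
  finally have pd33: "pd 2 (\<lambda>x. ?T x $ 3 $ 3) p
    = - 2 * K * (\<Lambda> + 4 * b / p $ 2) * p $ 2 / (u p)\<^sup>2 + 4 * K * b / (u p)\<^sup>2" .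
  have "pd 3 (\<lambda>x. ?T x $ i $ j) p = pd 3 (\<lambda>x. 0) p" if "(i, j) = (2, 3) \<or> (i, j) = (3, 2)" for i j
    by (rule pd_cong[OF open_M assms(1)]) (use that in \<open>auto simp: energy_momentum_g vector_4\<close>)
  hence pd23: "pd 3 (\<lambda>x. ?T x $ 2 $ 3) p = 0" "pd 3 (\<lambda>x. ?T x $ 3 $ 2) p = 0"
    by (simp_all add: pd_const)
  have T: "?T p $ i $ j = K * vector [
    vector [T_base \<Lambda> p * A p, T_base \<Lambda> p, 0, 0],
    vector [T_base \<Lambda> p, 0, 0, 0],
    vector [0, 0, - ((\<Lambda> + 4 * b / p $ 2) * (p $ 2 / u p)\<^sup>2), 0],
    vector [0, 0, 0, - ((\<Lambda> + 4 * b / p $ 2) * (p $ 2 / u p)\<^sup>2)]] $ i $ j" for i j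
    by (simp add: energy_momentum_g[OF assms(1)] K_def)
  show "D 2 3 3 = K / (u p)\<^sup>2 * (4 * b)"
    and "D 3 2 3 = K / (u p)\<^sup>2 * ((2 * a - 4 * b * p $ 2 - RT_F f (proj34 p)) / p $ 2)"
    and "D 3 3 2 = K / (u p)\<^sup>2 * ((2 * a - 4 * b * p $ 2 - RT_F f (proj34 p)) / p $ 2)"
    unfolding D_def cov_deriv_coord_fields pd33 pd23 christoffel_g[OF assms(1)] T
    using u_nonzero[OF assms(1)] r_nonzero[OF assms(1)]
    by (simp_all add: sum_4 vector_4 \<Gamma>_def T_base_def field_simps power2_eq_square)
qed

section \<open>Necessity of b = 0 and F = 2a\<close>

lemma vacuumI:
  assumes "M \<noteq> {}" "k \<noteq> 0" "\<And>p. p \<in> M \<Longrightarrow> k * b * p $ 2 = 2 * a - RT_F f (proj34 p)"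
  shows "b = 0 \<and> (\<forall>x\<in>proj34 ` M. RT_F f x = 2 * a)"
proof -
  obtain p where p: "p \<in> M" using assms(1) by blast
  obtain \<epsilon> where \<epsilon>: "\<epsilon> > 0" "ball p \<epsilon> \<subseteq> M" using open_M p openE by blast
  \<comment> \<open>A neighbour in the \<open>r\<close>-direction, kept in the ball by half its
    radius. \<open>F\<close> is the same at both points, so subtracting the two equations leaves
    \<open>k * b * \<epsilon> / 2 = 0\<close>.\<close>
  define p' where "p' = p + (\<epsilon> / 2) *\<^sub>R axis 2 1"
  have "p' \<in> M"
    using \<epsilon> by (intro subsetD[OF \<epsilon>(2)]) (simp add: p'_def dist_norm norm_axis_1)
  moreover have "p' $ 2 = p $ 2 + \<epsilon> / 2" "proj34 p' = proj34 p"
    by (simp_all add: p'_def proj34_add_axis)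
  ultimately have "k * b * (p $ 2 + \<epsilon> / 2) = k * b * p $ 2"
    using assms(3)[of p'] assms(3)[OF p] by simp
  hence "b = 0" using assms(2) \<epsilon>(1) by (simp add: algebra_simps)
  thus ?thesis using assms(3) by auto
qed

lemma codazzi_imp_vacuum:
  assumes "c > 0" "G > 0" "M \<noteq> {}" "codazzi_on M g (energy_momentum c G \<Lambda> g)"
  shows "b = 0 \<and> (\<forall>x\<in>proj34 ` M. RT_F f x = 2 * a)"
proof (rule vacuumI[OF assms(3), of 8])
  fix p assume p: "p \<in> M"
  let ?D = "\<lambda>k i j. cov_deriv g (energy_momentum c G \<Lambda> g) (coord_field k) (coord_field i) (coord_field j) p"
  have "?D 2 3 3 = ?D 3 2 3"
    using assms(4) smooth_vfield_coord_field p unfolding codazzi_on_def by blast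
  moreover have "c ^ 4 / (8 * pi * G) / (u p)\<^sup>2 \<noteq> 0"
    using assms(1,2) u_nonzero[OF p] by simp
  ultimately have "4 * b = (2 * a - 4 * b * p $ 2 - RT_F f (proj34 p)) / p $ 2"
    unfolding cov_deriv_energy_momentum[OF p] using mult_cancel_left by blast
  thus "8 * b * p $ 2 = 2 * a - RT_F f (proj34 p)"
    using r_nonzero[OF p] by (simp add: field_simps)
qed simp

lemma cyclic_parallel_imp_vacuum:
  assumes "c > 0" "G > 0" "M \<noteq> {}" "cyclic_parallel_on M g (energy_momentum c G \<Lambda> g)"
  shows "b = 0 \<and> (\<forall>x\<in>proj34 ` M. RT_F f x = 2 * a)"
proof (rule vacuumI[OF assms(3), of 2])
  fix p assume p: "p \<in> M"
  let ?D = "\<lambda>k i j. cov_deriv g (energy_momentum c G \<Lambda> g) (coord_field k) (coord_field i) (coord_field j) p"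
  have cancel: "x + 2 * y = 0" if "K \<noteq> 0" "K * x + K * y + K * y = 0" for K x y :: real
  proof -
    have "K * (x + 2 * y) = 0" using that(2) by (simp add: algebra_simps)
    thus ?thesis using that(1) by simp
  qed
  \<comment> \<open>With the fields of indices 2, 3, 3 the cyclic sum contains the mixed component
    twice.\<close>
  have "?D 2 3 3 + ?D 3 3 2 + ?D 3 2 3 = 0"
    using assms(4) smooth_vfield_coord_field p unfolding cyclic_parallel_on_def by blast
  moreover have "c ^ 4 / (8 * pi * G) / (u p)\<^sup>2 \<noteq> 0"
    using assms(1,2) u_nonzero[OF p] by simp
  ultimately have "4 * b + 2 * ((2 * a - 4 * b * p $ 2 - RT_F f (proj34 p)) / p $ 2) = 0"
    unfolding cov_deriv_energy_momentum[OF p] by (rule cancel[rotated])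
  thus "2 * b * p $ 2 = 2 * a - RT_F f (proj34 p)"
    using r_nonzero[OF p] by (simp add: field_simps)
qed simp

section \<open>Sufficiency of b = 0 and F = 2a\<close>

lemma energy_momentum_vacuum:
  assumes "b = 0" "\<forall>x\<in>proj34 ` M. RT_F f x = 2 * a" "p \<in> M"
  shows "energy_momentum c G \<Lambda> g p = (c ^ 4 / (8 * pi * G) * \<Lambda>) *\<^sub>R g p"
proof -
  have "RT_F f (proj34 p) = 2 * a" using assms(2,3) by blast
  hence "ricci g p = 0" "scalar_curvature g p = 0"
    unfolding ricci_g[OF assms(3)] scalar_curvature_g[OF assms(3)]
    by (simp_all add: assms(1) vec_eq_iff forall_4 vector_4)
  thus ?thesis by (simp add: energy_momentum_def)
qed

lemma differentiable_g:
  assumes "p \<in> M"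
  shows "(\<lambda>x. g x $ i $ j) differentiable (at p)"
proof -
  have "proj34 differentiable (at p)" by (rule linear_imp_differentiable[OF linear_proj34])
  hence u: "u differentiable (at p)"
    unfolding u_def[abs_def] by (rule differentiable_compose[where f = f and g = proj34, OF differentiable_f(1)[OF assms]])
  have r: "(\<lambda>x::real^4. x $ 2) differentiable (at p)"
    by (rule linear_imp_differentiable) (simp add: linearI)
  have w: "(\<lambda>x. - (x $ 2 / u x)\<^sup>2) differentiable (at p)"
    using u_nonzero[OF assms] u r by (intro differentiable_minus differentiable_power differentiable_divide)
  have A: "A differentiable (at p)"
    unfolding A_def[abs_def] using r_nonzero[OF assms] r
    by (intro differentiable_mult differentiable_diff differentiable_divide differentiable_const)
  have "\<forall>i j. (\<lambda>x. g x $ i $ j) differentiable (at p)"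
    unfolding g_eq using A w by (simp add: forall_4 vector_4)
  thus ?thesis by blast
qed

text \<open>Arbitrary smooth fields have to be handled here. \<open>T\<close> is a constant multiple
  of \<open>g\<close> throughout \<open>M\<close>, so scaling reduces the claim to metric
  compatibility of the connection.\<close>

lemma covariantly_constant_vacuum:
  assumes "b = 0" "\<forall>x\<in>proj34 ` M. RT_F f x = 2 * a"
  shows "covariantly_constant_on M g (energy_momentum c G \<Lambda> g)"
  unfolding covariantly_constant_on_def
proof (intro allI impI ballI)
  fix X Y Z p
  assume Y: "smooth_vfield_on M Y" and Z: "smooth_vfield_on M Z" and p: "p \<in> M"
  have dY: "(\<lambda>x. Y x $ i) differentiable (at p)" and dZ: "(\<lambda>x. Z x $ i) differentiable (at p)" for i
    using Y Z p by (auto simp: smooth_vfield_on_def intro: smooth_on_imp_differentiable)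
  show "cov_deriv g (energy_momentum c G \<Lambda> g) X Y Z p = 0"
    using cov_deriv_scaleR[OF open_M p energy_momentum_vacuum[OF assms] differentiable_g[OF p] dY dZ]
      levi_civita_metric[OF open_M p g_sym invertible_g[OF p] differentiable_g[OF p] dY dZ]
    by simp
qed

end

theorem theorem5p1:
  fixes a b q c G \<Lambda> :: real
    and f :: "real^2 \<Rightarrow> real"
    and M :: "(real^4) set"
    and g T :: "real^4 \<Rightarrow> real^4^4"
  assumes "c > 0" and "G > 0"
    and "open M" and "connected M" and "M \<noteq> {}"
    and "\<forall>p\<in>M. p $ 2 \<noteq> 0"
    and "smooth_on (proj34 ` M) f"
    and "\<forall>x\<in>proj34 ` M. f x \<noteq> 0"
    and "g = robinson_trautman a b q f"
    and "T = energy_momentum c G \<Lambda> g"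
  shows "(covariantly_constant_on M g T \<longleftrightarrow> codazzi_on M g T)
       \<and> (codazzi_on M g T \<longleftrightarrow> cyclic_parallel_on M g T)
       \<and> (cyclic_parallel_on M g T \<longleftrightarrow> b = 0 \<and> (\<forall>x\<in>proj34 ` M. RT_F f x = 2 * a))"
proof -
  interpret robinson_trautman_region a b q f M
    using assms(3,6-8) by unfold_locales auto
  let ?iv = "b = 0 \<and> (\<forall>x\<in>proj34 ` M. RT_F f x = 2 * a)"
  \<comment> \<open>The implications run from (iv) to (i), from (i) to both (ii) and (iii), and from
    each of these back to (iv).\<close>
  have "?iv \<Longrightarrow> covariantly_constant_on M g T"
    unfolding assms(9,10) using covariantly_constant_vacuum by blast
  moreover have "covariantly_constant_on M g T \<Longrightarrow> codazzi_on M g T"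
    unfolding covariantly_constant_on_def codazzi_on_def by simp
  moreover have "covariantly_constant_on M g T \<Longrightarrow> cyclic_parallel_on M g T"
    unfolding covariantly_constant_on_def cyclic_parallel_on_def by simp
  moreover have "codazzi_on M g T \<Longrightarrow> ?iv"
    unfolding assms(9,10) by (rule codazzi_imp_vacuum[OF assms(1,2,5)])
  moreover have "cyclic_parallel_on M g T \<Longrightarrow> ?iv"
    unfolding assms(9,10) by (rule cyclic_parallel_imp_vacuum[OF assms(1,2,5)])
  ultimately show ?thesis by blast
qed

end
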